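(* Let $X=\prod_{i=1}^N X_i\subseteq\mathbb{R}^n$, where the sets $X_i\subseteq\mathbb{R}^{n_i}$ are closed and convex and $n=\sum_{i=1}^N n_i$, and let $F:X\to\mathbb{R}^n$ be strongly monotone with constant $\eta>0$ and Lipschitz continuous with constant $L$ over $X$. Let $0\le\beta<\frac{\eta}{L}$, let $\nu>0$, and let $e_0>0$ be such that $e_0<\frac{2\nu^2}{L^2}$. Define real-valued functions $e_k(\delta_0,\dots,\delta_{k-1})$ recursively, starting from the constant $e_0$, by $$e_{k+1}(\delta_0,\dots,\delta_k)=(1-(\eta-\beta L)\delta_k)\,e_k(\delta_0,\dots,\delta_{k-1})+(1+\beta)^2\delta_k^2\nu^2\qquad\text{for all }k\ge0.$$ Let the sequence $\{\delta_k^*\}$ be given by $$\delta_0^*=\frac{\eta-\beta L}{2(1+\beta)^2\nu^2}\,e_0,\qquad \delta_k^*=\delta_{k-1}^*\Bigl(1-\frac{\eta-\beta L}{2}\,\delta_{k-1}^*\Bigr)\quad\text{for all }k\ge1.$$ Then the following hold: (a) $e_k(\delta_0^*,\dots,\delta_{k-1}^* )=\frac{2(1+\beta)^2\nu^2}{\eta-\beta L}\,\delta_k^*$ for all $k\ge0$ (for $k=0$ the left side is the constant $e_0$). (b) For any $k\ge1$, the vector $(\delta_0^*,\delta_1^*,\dots,\delta_{k-1}^* )$ is the minimizer of the function $e_k(\delta_0,\dots,\delta_{k-1})$ over the set $$\mathbb{G}_k=\Bigl\{\alpha\in\mathbb{R}^k: 0<\alpha_j\le\frac{\eta-\beta L}{(1+\beta)^2L^2},\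 j=1,\dots,k\Bigr\};$$ i.e., for any $k\ge1$ and any $(\delta_0,\dots,\delta_{k-1})\in\mathbb{G}_k$, $$e_k(\delta_0,\dots,\delta_{k-1})-e_k(\delta_0^*,\dots,\delta_{k-1}^* )\ge(1+\beta)^2\nu^2(\delta_{k-1}-\delta_{k-1}^* )^2.$$
   Context: $\|\cdot\|$ is the Euclidean norm. $F$ is strongly monotone on $X$ with constant $\eta$ if $(F(x)-F(y))^T(x-y)\ge\eta\|x-y\|^2$ for all $x,y\in X$; it is Lipschitz with constant $L$ if $\|F(x)-F(y)\|\le L\|x-y\|$ for all $x,y\in X$. The functions $e_k$ model an upper bound on the mean squared error of a distributed projected stochastic approximation scheme for the variational inequality defined by $X$ and $F$; there $\nu^2$ is an upper bound on the conditional second moments of the norms of the stochastic errors in evaluating $F$, $\delta_k$ is a lower bound on the players' stepsizes at iteration $k$, and $\beta$ bounds the relative spread of the stepsizes. Only the constants $\eta,L,\beta,\nu,e_0$ enter the conclusions.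
   Formalization: Part (b) is stated for sets X with at least two distinct points (which forces η ≤ L); it fails for one-point X, e.g. X={0}, F=0, η=4, L=1, β=0, ν=1, e_0=1, where δ_1*=-6 is not in the admissible range (0,4]. *)

theory Defs
  imports "HOL-Analysis.Analysis"
begin

text \<open>
  A splitting of \<open>\<real>\<^sup>n\<close> into the factors \<open>\<real>\<^bsup>n_i\<^esup>\<close> is given by a map \<open>owner\<close> that assigns
  each coordinate to one factor, so that \<open>n_i = card {j. owner j = i}\<close> and \<open>CARD('n)\<close> is the sum
  of the \<open>n_i\<close>. The factor \<open>\<real>\<^bsup>n_i\<^esup>\<close> is identified with the coordinate subspace of the vectors
  that vanish outside the coordinates of \<open>i\<close>; this keeps the norm, the topology and convexity.
\<close>

definition block_space :: "('n::finite \<Rightarrow> 'p) \<Rightarrow> 'p \<Rightarrow> (real ^ 'n) set" where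
  "block_space owner i = {x. \<forall>j. owner j \<noteq> i \<longrightarrow> x $ j = 0}"

definition block_proj :: "('n::finite \<Rightarrow> 'p) \<Rightarrow> 'p \<Rightarrow> real ^ 'n \<Rightarrow> real ^ 'n" where
  "block_proj owner i x = (\<chi> j. if owner j = i then x $ j else 0)"

definition block_product ::
  "('n::finite \<Rightarrow> 'p) \<Rightarrow> ('p \<Rightarrow> (real ^ 'n) set) \<Rightarrow> (real ^ 'n) set" where
  "block_product owner Xs = {x. \<forall>i. block_proj owner i x \<in> Xs i}"

definition strongly_monotone_on ::
  "real \<Rightarrow> ('a::real_inner) set \<Rightarrow> ('a \<Rightarrow> 'a) \<Rightarrow> bool" where
  "strongly_monotone_on \<eta> X F \<longleftrightarrow>
     (\<forall>x\<in>X. \<forall>y\<in>X. (F x - F y) \<bullet> (x - y) \<ge> \<eta> * (norm (x - y))\<^sup>2)"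

text \<open>
  The error function \<open>e\<^sub>k\<close>. The stepsizes are passed as a sequence, of which
  \<open>err \<eta> L \<beta> \<nu> e0 k\<close> reads only the entries \<open>0, \<dots>, k - 1\<close>.
\<close>

primrec err ::
  "real \<Rightarrow> real \<Rightarrow> real \<Rightarrow> real \<Rightarrow> real \<Rightarrow> nat \<Rightarrow> (nat \<Rightarrow> real) \<Rightarrow> real" where
  "err \<eta> L \<beta> \<nu> e0 0 \<delta> = e0"
| "err \<eta> L \<beta> \<nu> e0 (Suc k) \<delta> =
     (1 - (\<eta> - \<beta> * L) * \<delta> k) * err \<eta> L \<beta> \<nu> e0 k \<delta> + (1 + \<beta>)\<^sup>2 * (\<delta> k)\<^sup>2 * \<nu>\<^sup>2"

primrec opt_step :: "real \<Rightarrow> real \<Rightarrow> real \<Rightarrow> real \<Rightarrow> real \<Rightarrow> nat \<Rightarrow> real" where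
  "opt_step \<eta> L \<beta> \<nu> e0 0 = (\<eta> - \<beta> * L) / (2 * (1 + \<beta>)\<^sup>2 * \<nu>\<^sup>2) * e0"
| "opt_step \<eta> L \<beta> \<nu> e0 (Suc k) =
     opt_step \<eta> L \<beta> \<nu> e0 k * (1 - (\<eta> - \<beta> * L) / 2 * opt_step \<eta> L \<beta> \<nu> e0 k)"

text \<open>
  The set \<open>\<bbbG>\<^sub>k\<close>, with \<open>\<real>\<^sup>k\<close> as the extensional functions on \<open>{..<k}\<close>. The coordinates are
  numbered from \<open>0\<close>, like the stepsizes.
\<close>

definition step_set :: "real \<Rightarrow> real \<Rightarrow> real \<Rightarrow> nat \<Rightarrow> (nat \<Rightarrow> real) set" where
  "step_set \<eta> L \<beta> k =
     {..<k} \<rightarrow>\<^sub>E {\<alpha>. 0 < \<alpha> \<and> \<alpha> \<le> (\<eta> - \<beta> * L) / ((1 + \<beta>)\<^sup>2 * L\<^sup>2)}"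

end

theory Submission
  imports Defs
begin

text \<open>
  Write \<open>m = \<eta> - \<beta>L\<close> and \<open>c = (1 + \<beta>)\<^sup>2\<nu>\<^sup>2\<close>, so that the recursion reads
  \<open>e\<^sub>k\<^sub>+\<^sub>1 = (1 - m\<delta>\<^sub>k)e\<^sub>k + c\<delta>\<^sub>k\<^sup>2\<close>. For fixed \<open>e\<^sub>k\<close> the right-hand side is quadratic in \<open>\<delta>\<^sub>k\<close> with
  vertex \<open>m e\<^sub>k / (2c)\<close>, which along the optimal steps is \<open>\<delta>\<^sub>k\<^sup>*\<close> itself. Completing the square gives
  \<open>e\<^sub>k\<^sub>+\<^sub>1(\<delta>) - e\<^sub>k\<^sub>+\<^sub>1(\<delta>\<^sup>*) = (1 - m\<delta>\<^sub>k)(e\<^sub>k(\<delta>) - e\<^sub>k(\<delta>\<^sup>*)) + c(\<delta>\<^sub>k - \<delta>\<^sub>k\<^sup>*)\<^sup>2\<close>. As soon as \<open>X\<close> has two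
  points, \<open>\<eta> \<le> L\<close>, hence \<open>m\<delta>\<^sub>k \<le> 1\<close> for feasible steps, and the claims follow by induction on \<open>k\<close>.
\<close>

text \<open>Both constants bound the same inner product, on the Lipschitz side via Cauchy-Schwarz;
  the squared distance cancels.\<close>

lemma strongly_monotone_constant_le_lipschitz_constant:
  assumes "strongly_monotone_on \<eta> X F" and "L-lipschitz_on X F"
    and "x \<in> X" "y \<in> X" "x \<noteq> y"
  shows "\<eta> \<le> L"
proof -
  have "\<eta> * (norm (x - y))\<^sup>2 \<le> (F x - F y) \<bullet> (x - y)"
    using assms by (simp add: strongly_monotone_on_def)
  also have "\<dots> \<le> norm (F x - F y) * norm (x - y)"
    by (rule norm_cauchy_schwarz)
  also have "\<dots> \<le> (L * norm (x - y)) * norm (x - y)"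
    using lipschitz_onD[OF assms(2-4)] by (intro mult_right_mono) (auto simp: dist_norm)
  finally have "\<eta> * (norm (x - y))\<^sup>2 \<le> L * (norm (x - y))\<^sup>2"
    by (simp add: power2_eq_square mult.assoc)
  then show ?thesis
    using \<open>x \<noteq> y\<close> by simp
qed

lemma err_cong:
  assumes "\<And>j. j < k \<Longrightarrow> \<delta> j = \<delta>' j"
  shows "err \<eta> L \<beta> \<nu> e0 k \<delta> = err \<eta> L \<beta> \<nu> e0 k \<delta>'"
  using assms by (induction k) auto

text \<open>Lets the total sequence \<open>opt_step\<close> compete with the extensional members of
  \<open>step_set\<close>.\<close>

lemma err_restrict [simp]:
  "err \<eta> L \<beta> \<nu> e0 k (restrict \<delta> {..<k}) = err \<eta> L \<beta> \<nu> e0 k \<delta>"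
  by (rule err_cong) simp

locale step_scheme =
  fixes \<eta> L \<beta> \<nu> e0 :: real
  assumes L_pos: "0 < L" and \<beta>_nonneg: "0 \<le> \<beta>" and \<beta>L_less: "\<beta> * L < \<eta>"
    and \<nu>_pos: "0 < \<nu>" and e0_pos: "0 < e0"
begin

abbreviation "e \<equiv> err \<eta> L \<beta> \<nu> e0"
abbreviation "d \<equiv> opt_step \<eta> L \<beta> \<nu> e0"
abbreviation "m \<equiv> \<eta> - \<beta> * L"
abbreviation "c \<equiv> (1 + \<beta>)\<^sup>2 * \<nu>\<^sup>2"
abbreviation "b \<equiv> m / ((1 + \<beta>)\<^sup>2 * L\<^sup>2)"

lemma \<nu>_neq_0: "\<nu> \<noteq> 0" and \<beta>_plus_1_neq_0: "1 + \<beta> \<noteq> 0"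
  using \<nu>_pos \<beta>_nonneg by auto

lemma m_pos: "0 < m"
  using \<beta>L_less by simp

lemma c_pos: "0 < c"
  using \<beta>_nonneg \<nu>_pos by simp

lemma err_opt_step: "e k d = 2 * c / m * d k"
proof (induction k)
  case 0
  have "2 * c / m * (m / (2 * c) * e0) = e0"
    using m_pos \<nu>_neq_0 \<beta>_plus_1_neq_0 by simp
  then show ?case
    by (simp add: mult.assoc)
next
  case (Suc k)
  have "e (Suc k) d = (1 - m * d k) * (2 * c / m * d k) + c * (d k)\<^sup>2"
    using Suc by (simp add: algebra_simps)
  also have "\<dots> = 2 * c / m * d (Suc k)"
    using m_pos by (simp add: field_simps power2_eq_square)
  finally show ?case .
qed

lemma err_Suc_diff:
  "e (Suc k) \<delta> - e (Suc k) d = (1 - m * \<delta> k) * (e k \<delta> - e k d) + c * (\<delta> k - d k)\<^sup>2"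
proof -
  have vertex: "m * e k d = 2 * c * d k"
    using m_pos by (simp add: err_opt_step)
  have "e (Suc k) \<delta> - e (Suc k) d - (1 - m * \<delta> k) * (e k \<delta> - e k d)
      = (d k - \<delta> k) * (m * e k d) + c * ((\<delta> k)\<^sup>2 - (d k)\<^sup>2)"
    by (simp add: algebra_simps)
  also have "\<dots> = c * (\<delta> k - d k)\<^sup>2"
    unfolding vertex by (simp add: power2_eq_square algebra_simps)
  finally show ?thesis
    by simp
qed

end

text \<open>\<open>\<eta>_le_L\<close> is the form in which two distinct points of \<open>X\<close>
  enter. On a singleton \<open>\<eta>\<close> may exceed \<open>L\<close>, and
  \<open>m * b \<le> 1\<close> can then fail.\<close>

locale feasible_step_scheme = step_scheme +
  assumes \<eta>_le_L: "\<eta> \<le> L" and e0_less: "e0 < 2 * \<nu>\<^sup>2 / L\<^sup>2"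
begin

text \<open>The chain \<open>m \<le> \<eta> \<le> L \<le> (1 + \<beta>) * L\<close>, squared,
  compares \<open>m\<close> with the denominator of \<open>b\<close>.\<close>

lemma m_mult_bound_le_1: "m * b \<le> 1"
proof -
  have "m \<le> (1 + \<beta>) * L"
    using \<eta>_le_L L_pos \<beta>_nonneg by (simp add: algebra_simps)
      (smt (verit) mult_nonneg_nonneg)
  then have "m\<^sup>2 \<le> (1 + \<beta>)\<^sup>2 * L\<^sup>2"
    using m_pos power_mono[of m "(1 + \<beta>) * L" 2] by (simp add: power_mult_distrib)
  then show ?thesis
    using L_pos \<beta>_nonneg by (simp add: divide_simps power2_eq_square)
qed

lemma m_mult_le_1: "\<alpha> \<le> b \<Longrightarrow> m * \<alpha> \<le> 1"
  using m_mult_bound_le_1 m_pos mult_left_mono[of \<alpha> b m] by linarith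

lemma m_mult_less_1: "\<alpha> < b \<Longrightarrow> m * \<alpha> < 1"
  using m_mult_bound_le_1 m_pos mult_strict_left_mono[of \<alpha> b m] by linarith

text \<open>The bound on \<open>e0\<close> amounts to \<open>d 0 < b\<close>. From there
  \<open>0 < m * d k < 1\<close> keeps the factor \<open>1 - m / 2 * d k\<close> between 0 and 1, so
  the steps decrease and stay positive.\<close>

lemma opt_step_bounds: "0 < d k \<and> d k < b"
proof (induction k)
  case 0
  have "m / (2 * c) * e0 < m / (2 * c) * (2 * \<nu>\<^sup>2 / L\<^sup>2)"
    using e0_less m_pos c_pos by (intro mult_strict_left_mono) auto
  also have "\<dots> = b"
    using \<nu>_pos by simp
  finally show ?case
    using m_pos c_pos e0_pos by (simp add: mult.assoc)
next
  case (Suc k)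
  then have "0 < d k" "0 < m * d k" "m * d k < 1"
    using m_pos m_mult_less_1 by auto
  then have "0 < 1 - m / 2 * d k" "1 - m / 2 * d k < 1"
    by simp_all
  then have "0 < d (Suc k)" "d (Suc k) < d k * 1"
    unfolding opt_step.simps using \<open>0 < d k\<close> by (auto intro!: mult_pos_pos mult_strict_left_mono)
  then show ?case
    using Suc.IH by linarith
qed

lemma restrict_opt_step_in_step_set: "restrict d {..<k} \<in> step_set \<eta> L \<beta> k"
  using opt_step_bounds by (auto simp: step_set_def intro: less_imp_le)

lemma err_opt_step_le:
  assumes "\<And>j. j < k \<Longrightarrow> \<delta> j \<le> b"
  shows "e k d \<le> e k \<delta>"
  using assms
proof (induction k)
  case (Suc k)
  have "0 \<le> (1 - m * \<delta> k) * (e k \<delta> - e k d)"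
    using Suc m_mult_le_1[of "\<delta> k"] by (intro mult_nonneg_nonneg) simp_all
  moreover have "0 \<le> c * (\<delta> k - d k)\<^sup>2"
    by simp
  ultimately show ?case
    using err_Suc_diff[of k \<delta>] by linarith
qed simp

text \<open>In \<open>err_Suc_diff\<close> the gap inherited from the previous stage is nonnegative
  by \<open>err_opt_step_le\<close>; dropping it leaves the last square.\<close>

lemma err_growth:
  assumes "\<And>j. j < k \<Longrightarrow> \<delta> j \<le> b" and "1 \<le> k"
  shows "c * (\<delta> (k - 1) - d (k - 1))\<^sup>2 \<le> e k \<delta> - e k d"
proof -
  obtain j where k: "k = Suc j"
    using \<open>1 \<le> k\<close> by (cases k) auto
  have "0 \<le> (1 - m * \<delta> j) * (e j \<delta> - e j d)"
    using assms m_mult_le_1[of "\<delta> j"] err_opt_step_le[of j \<delta>] k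
    by (intro mult_nonneg_nonneg) simp_all
  then show ?thesis
    using err_Suc_diff[of j \<delta>] k by simp
qed

text \<open>
  Here the strict inequality \<open>e0 < 2\<nu>\<^sup>2/L\<^sup>2\<close> matters: it makes \<open>1 - m\<delta>\<^sub>k\<^sup>*\<close> positive, so that an equality
  at \<open>k + 1\<close> is passed down to \<open>k\<close>.
\<close>

lemma err_eq_opt_imp_eq:
  assumes "\<And>j. j < k \<Longrightarrow> \<delta> j \<le> b" and "e k \<delta> \<le> e k d" and "j < k"
  shows "\<delta> j = d j"
  using assms
proof (induction k)
  case (Suc k)
  have "c * (\<delta> k - d k)\<^sup>2 \<le> 0"
    using err_growth[of "Suc k" \<delta>] Suc.prems by simp
  then have last: "\<delta> k = d k"
    using \<nu>_neq_0 \<beta>_plus_1_neq_0 by (simp add: mult_le_0_iff)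
  then have "(1 - m * d k) * (e k \<delta> - e k d) \<le> 0"
    using err_Suc_diff[of k \<delta>] Suc.prems(2) by simp
  moreover have "0 < 1 - m * d k"
    using m_mult_less_1 opt_step_bounds by simp
  ultimately have "e k \<delta> \<le> e k d"
    by (simp only: mult_le_0_iff) linarith
  then show ?case
    using Suc last by (cases "j = k") auto
qed simp

lemma is_arg_min_err_iff:
  "is_arg_min (e k) (\<lambda>\<delta>. \<delta> \<in> step_set \<eta> L \<beta> k) \<alpha> \<longleftrightarrow> \<alpha> = restrict d {..<k}"
proof
  assume "is_arg_min (e k) (\<lambda>\<delta>. \<delta> \<in> step_set \<eta> L \<beta> k) \<alpha>"
  then have \<alpha>: "\<alpha> \<in> step_set \<eta> L \<beta> k" and "e k \<alpha> \<le> e k (restrict d {..<k})"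
    using restrict_opt_step_in_step_set[of k] unfolding is_arg_min_linorder by blast+
  then have "\<alpha> j = d j" if "j < k" for j
    using that by (intro err_eq_opt_imp_eq[of k]) (auto simp: step_set_def)
  \<comment> \<open>Outside \<open>{..<k}\<close> both functions are \<open>undefined\<close>, so
    agreement below \<open>k\<close> suffices.\<close>
  then show "\<alpha> = restrict d {..<k}"
    using \<alpha> by (intro extensionalityI[of _ "{..<k}"]) (auto simp: step_set_def PiE_def)
next
  assume "\<alpha> = restrict d {..<k}"
  then show "is_arg_min (e k) (\<lambda>\<delta>. \<delta> \<in> step_set \<eta> L \<beta> k) \<alpha>"
    using restrict_opt_step_in_step_set
    by (auto simp: is_arg_min_linorder step_set_def intro!: err_opt_step_le)
qed

end

theorem proposition2:
  fixes owner :: "'n::finite \<Rightarrow> 'p::finite"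
    and Xs :: "'p \<Rightarrow> (real ^ 'n) set"
    and X :: "(real ^ 'n) set"
    and F :: "real ^ 'n \<Rightarrow> real ^ 'n"
    and \<eta> L \<beta> \<nu> e0 :: real
  defines "X \<equiv> block_product owner Xs"
  assumes "\<And>i. Xs i \<subseteq> block_space owner i"
    and "\<And>i. closed (Xs i)"
    and "\<And>i. convex (Xs i)"
    and "\<eta> > 0"
    and "strongly_monotone_on \<eta> X F"
    and "L-lipschitz_on X F"
    and "0 \<le> \<beta>" and "\<beta> < \<eta> / L"
    and "\<nu> > 0"
    and "e0 > 0" and "e0 < 2 * \<nu>\<^sup>2 / L\<^sup>2"
  shows "(\<forall>k. err \<eta> L \<beta> \<nu> e0 k (opt_step \<eta> L \<beta> \<nu> e0)
            = 2 * (1 + \<beta>)\<^sup>2 * \<nu>\<^sup>2 / (\<eta> - \<beta> * L) * opt_step \<eta> L \<beta> \<nu> e0 k)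
    \<and> ((\<exists>x\<in>X. \<exists>y\<in>X. x \<noteq> y) \<longrightarrow>
        (\<forall>k\<ge>1.
           (\<forall>\<alpha>. is_arg_min (err \<eta> L \<beta> \<nu> e0 k) (\<lambda>\<delta>. \<delta> \<in> step_set \<eta> L \<beta> k) \<alpha>
              \<longleftrightarrow> \<alpha> = restrict (opt_step \<eta> L \<beta> \<nu> e0) {..<k}) \<and>
           (\<forall>\<delta>\<in>step_set \<eta> L \<beta> k.
              err \<eta> L \<beta> \<nu> e0 k \<delta> - err \<eta> L \<beta> \<nu> e0 k (opt_step \<eta> L \<beta> \<nu> e0)
                \<ge> (1 + \<beta>)\<^sup>2 * \<nu>\<^sup>2 * (\<delta> (k - 1) - opt_step \<eta> L \<beta> \<nu> e0 (k - 1))\<^sup>2)))"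
proof -
  \<comment> \<open>With \<open>x / 0 = 0\<close>, the case \<open>L = 0\<close> would turn the
    upper bound on \<open>e0\<close> into \<open>e0 < 0\<close>.\<close>
  have "L \<noteq> 0"
    using \<open>e0 > 0\<close> \<open>e0 < 2 * \<nu>\<^sup>2 / L\<^sup>2\<close> by auto
  then have "L > 0"
    using lipschitz_on_nonneg[OF \<open>L-lipschitz_on X F\<close>] by simp
  then have "\<beta> * L < \<eta>"
    using \<open>\<beta> < \<eta> / L\<close> by (simp add: field_simps)
  then interpret step_scheme \<eta> L \<beta> \<nu> e0
    using \<open>L > 0\<close> assms by unfold_locales auto
  show ?thesis
  proof (intro conjI impI allI ballI)
    show "err \<eta> L \<beta> \<nu> e0 k (opt_step \<eta> L \<beta> \<nu> e0)
        = 2 * (1 + \<beta>)\<^sup>2 * \<nu>\<^sup>2 / (\<eta> - \<beta> * L) * opt_step \<eta> L \<beta> \<nu> e0 k" for k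
      using err_opt_step[of k] by (simp add: mult.assoc)
  next
    assume "\<exists>x\<in>X. \<exists>y\<in>X. x \<noteq> y"
    then interpret feasible_step_scheme \<eta> L \<beta> \<nu> e0
      using assms strongly_monotone_constant_le_lipschitz_constant[of \<eta> X F L]
      by unfold_locales auto
    fix k :: nat
    assume "1 \<le> k"
    show "is_arg_min (e k) (\<lambda>\<delta>. \<delta> \<in> step_set \<eta> L \<beta> k) \<alpha> \<longleftrightarrow> \<alpha> = restrict d {..<k}" for \<alpha>
      by (rule is_arg_min_err_iff)
    show "c * (\<delta> (k - 1) - d (k - 1))\<^sup>2 \<le> e k \<delta> - e k d" if "\<delta> \<in> step_set \<eta> L \<beta> k" for \<delta>
      using that \<open>1 \<le> k\<close> by (intro err_growth) (auto simp: step_set_def)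
  qed
qed

end
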